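(* Let $n\geq 3$ be an integer. Then $\#\mathcal F_n=(n^2-3n+4)/2$; $\#\mathcal F_n^+=(n^2-2n+5)/4$ if $n$ is odd and $\#\mathcal F_n^+=(n^2-2n+4)/4$ if $n$ is even; and $\#(\mathcal F_n^+\times\mathcal T_n)=(n^3-3n^2+7n-5)/4$ if $n$ is odd and $(n^3-3n^2+6n-4)/4$ if $n$ is even.
   Context: $f_n$ denotes the Fibonacci sequence: $f_0=0$, $f_1=1$, $f_n=f_{n-1}+f_{n-2}$ for $n\geq 2$. For integers $1\leq k<\ell\leq n$, ${\bf y}_n(k,\ell)=(y_1,\ldots,y_n)^T\in\mathbb R^n$ has $y_k=(-1)^{\ell-k+1}f_{n-\ell}/f_{\ell-k}$, $y_\ell=f_{n-k}/f_{\ell-k}$, and $y_i=0$ for $i\notin\{k,\ell\}$. $\mathcal F_n=\{{\bf y}_n(k,\ell):1\leq k<\ell\leq n\}$ and $\mathcal F_n^+=\{{\bf y}_n(k,\ell):1\leq k<\ell\leq n,\ \ell-k\text{ odd}\}$ (sets of vectors, so coinciding vectors are counted once). $\mathcal T_n=\{t_1,\ldots,t_{n-1}\}$ where $t_1>t_2>\cdots>t_{n-1}$ are positive real numbers. *)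

theory Defs
  imports "HOL-Number_Theory.Fib" "Jordan_Normal_Form.Matrix"
begin

(* Coordinates of ''vec'' are numbered from 0, so the i-th coordinate in the 1-based numbering
   used for k and l sits at index i - 1. *)
definition y_vec :: "nat \<Rightarrow> nat \<Rightarrow> nat \<Rightarrow> real vec" where
  "y_vec n k l = vec n (\<lambda>i.
     if i + 1 = k then (-1) ^ (l - k + 1) * real (fib (n - l)) / real (fib (l - k))
     else if i + 1 = l then real (fib (n - k)) / real (fib (l - k))
     else 0)"

definition F_set :: "nat \<Rightarrow> real vec set" where
  "F_set n = {y_vec n k l | k l. 1 \<le> k \<and> k < l \<and> l \<le> n}"

definition F_plus_set :: "nat \<Rightarrow> real vec set" where
  "F_plus_set n = {y_vec n k l | k l. 1 \<le> k \<and> k < l \<and> l \<le> n \<and> odd (l - k)}"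

definition T_set :: "nat \<Rightarrow> (nat \<Rightarrow> real) \<Rightarrow> real set" where
  "T_set n t = t ` {1..n - 1}"

end

theory Submission
  imports Defs
begin

text \<open>
  If \<open>l = n\<close> the entry at \<open>k\<close> vanishes and the one at \<open>l\<close> is 1, so all these vectors equal the
  last unit vector. If \<open>l < n\<close> then both entries are nonzero, so the support determines
  \<open>(k, l)\<close> and is not a singleton. Hence the number of vectors exceeds the number
  of admissible pairs \<open>k < l < n\<close> by exactly one.
\<close>

definition vec_support :: "real vec \<Rightarrow> nat set" where
  "vec_support v = {i. i < dim_vec v \<and> v $ i \<noteq> 0}"

text \<open>The predicate \<open>P\<close> on the difference serves both families at once:
  constantly true for \<open>F_set\<close>, \<open>odd\<close> for \<open>F_plus_set\<close>. The
  strict bound \<open>l < n\<close> leaves out the pairs whose vectors coincide.\<close>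

definition index_pairs :: "(nat \<Rightarrow> bool) \<Rightarrow> nat \<Rightarrow> (nat \<times> nat) set" where
  "index_pairs P n = {(k, l). 1 \<le> k \<and> k < l \<and> l < n \<and> P (l - k)}"

lemma fib_eq_0_iff: "fib n = 0 \<longleftrightarrow> n = 0"
  using fib_neq_0_nat[of n] by (cases n) auto

lemma vec_support_y_vec:
  assumes "1 \<le> k" "k < l" "l < n"
  shows "vec_support (y_vec n k l) = {k - 1, l - 1}"
  using assms by (auto simp: vec_support_def y_vec_def fib_eq_0_iff split: if_splits)

lemma y_vec_last:
  assumes "1 \<le> k" "k < n"
  shows "y_vec n k n = unit_vec n (n - 1)"
  using assms by (intro eq_vecI) (auto simp: y_vec_def unit_vec_def fib_eq_0_iff)

lemma vec_support_unit_vec: "i < n \<Longrightarrow> vec_support (unit_vec n i) = {i}"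
  by (auto simp: vec_support_def unit_vec_def split: if_splits)

lemma inj_on_y_vec: "inj_on (\<lambda>(k, l). y_vec n k l) (index_pairs P n)"
proof (rule inj_onI, clarify)
  fix k l k' l'
  assume kl: "(k, l) \<in> index_pairs P n" and kl': "(k', l') \<in> index_pairs P n"
    and eq: "y_vec n k l = y_vec n k' l'"
  then have "{k - 1, l - 1} = {k' - 1, l' - 1}"
    using vec_support_y_vec[of k l n] vec_support_y_vec[of k' l' n]
    by (simp add: index_pairs_def)
  \<comment> \<open>Since all indices are at least 1, subtracting 1 loses nothing, and
    \<open>k < l\<close>, \<open>k' < l'\<close> exclude the crosswise match of the
    doubletons.\<close>
  with kl kl' show "k = k' \<and> l = l'"
    by (auto simp: index_pairs_def doubleton_eq_iff)
qed

lemma unit_vec_notin_y_vec: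
  "unit_vec n (n - 1) \<notin> (\<lambda>(k, l). y_vec n k l) ` index_pairs P n"
proof
  assume "unit_vec n (n - 1) \<in> (\<lambda>(k, l). y_vec n k l) ` index_pairs P n"
  then obtain k l where kl: "1 \<le> k" "k < l" "l < n" and eq: "unit_vec n (n - 1) = y_vec n k l"
    by (auto simp: index_pairs_def)
  from kl eq have "{k - 1, l - 1} = {n - 1}"
    using vec_support_y_vec[of k l n] vec_support_unit_vec[of "n - 1" n] by simp
  with kl show False
    by (auto simp: doubleton_eq_iff)
qed

lemma finite_index_pairs: "finite (index_pairs P n)"
  by (rule finite_subset[of _ "{..n} \<times> {..n}"]) (auto simp: index_pairs_def)

text \<open>The hypothesis \<open>P 1\<close> makes the pair \<open>(n - 1, n)\<close> admissible,
  so the last unit vector really occurs and accounts for the \<open>Suc\<close>.\<close>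

lemma card_y_vecs:
  assumes "n \<ge> 2" "P 1"
  shows "card {y_vec n k l | k l. 1 \<le> k \<and> k < l \<and> l \<le> n \<and> P (l - k)}
    = Suc (card (index_pairs P n))"
proof -
  have "{y_vec n k l | k l. 1 \<le> k \<and> k < l \<and> l \<le> n \<and> P (l - k)}
      = insert (unit_vec n (n - 1)) ((\<lambda>(k, l). y_vec n k l) ` index_pairs P n)"
    (is "?L = insert ?u ?R")
  proof
    show "?L \<subseteq> insert ?u ?R"
    proof clarify
      fix k l
      assume kl: "1 \<le> k" "k < l" "l \<le> n" "P (l - k)" and "y_vec n k l \<notin> ?R"
      \<comment> \<open>Among the conditions defining \<open>index_pairs\<close>, only
        \<open>l < n\<close> can fail here.\<close>
      then have "(k, l) \<notin> index_pairs P n"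
        by (auto intro: rev_image_eqI)
      with kl have "l = n"
        by (auto simp: index_pairs_def)
      with kl show "y_vec n k l = ?u"
        by (simp add: y_vec_last)
    qed
    have "?u = y_vec n (n - 1) n"
      using assms by (subst y_vec_last) auto
    then have "?u \<in> ?L"
      using assms by (intro CollectI exI[of _ "n - 1"] exI[of _ n]) auto
    moreover have "?R \<subseteq> ?L"
      unfolding index_pairs_def by clarify (metis less_imp_le)
    ultimately show "insert ?u ?R \<subseteq> ?L"
      by blast
  qed
  then show ?thesis
    using unit_vec_notin_y_vec[of n P]
    by (simp add: card_image[OF inj_on_y_vec] finite_index_pairs)
qed

text \<open>The new pairs are those with \<open>l = n\<close>. They are parametrised by their
  difference \<open>d = n - k\<close>, which is what \<open>P\<close> tests;
  \<open>1 \<le> k\<close> gives \<open>d < n\<close>.\<close>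

lemma card_index_pairs_Suc:
  "card (index_pairs P (Suc n)) = card (index_pairs P n) + card {d \<in> {1..<n}. P d}"
proof -
  let ?D = "{d \<in> {1..<n}. P d}"
  have "x \<in> (\<lambda>d. (n - d, n)) ` ?D"
    if "x \<in> index_pairs P (Suc n)" "x \<notin> index_pairs P n" for x
  proof (rule image_eqI)
    show "x = (n - (n - fst x), n)" "n - fst x \<in> ?D"
      using that by (auto simp: index_pairs_def less_Suc_eq)
  qed
  moreover have "index_pairs P n \<subseteq> index_pairs P (Suc n)"
    "(\<lambda>d. (n - d, n)) ` ?D \<subseteq> index_pairs P (Suc n)"
    by (auto simp: index_pairs_def)
  ultimately have "index_pairs P (Suc n) = index_pairs P n \<union> (\<lambda>d. (n - d, n)) ` ?D"
    by blast
  moreover have "index_pairs P n \<inter> (\<lambda>d. (n - d, n)) ` ?D = {}"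
    by (auto simp: index_pairs_def)
  moreover have "inj_on (\<lambda>d. (n - d, n)) ?D"
    by (auto simp: inj_on_def)
  ultimately show ?thesis
    by (simp add: card_Un_disjoint finite_index_pairs card_image)
qed

lemma card_odd_below: "card {d \<in> {1..<n}. odd d} = n div 2"
proof (induction n)
  case (Suc n)
  have "{d \<in> {1..<Suc n}. odd d} =
      (if odd n then insert n {d \<in> {1..<n}. odd d} else {d \<in> {1..<n}. odd d})"
    by (auto simp: less_Suc_eq elim: oddE)
  with Suc show ?case
    by auto
qed simp

lemma index_pairs_0: "index_pairs P 0 = {}"
  by (simp add: index_pairs_def)

lemma card_index_pairs_all:
  "n \<ge> 1 \<Longrightarrow> real (card (index_pairs (\<lambda>_. True) n)) = (real n - 1) * (real n - 2) / 2"
\<comment> \<open>The induction starts at 1 because at 0 the formula would give 1, although there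
  are no pairs.\<close>
proof (induction n rule: nat_induct_at_least)
  case base
  show ?case
    using card_index_pairs_Suc[of "\<lambda>_. True" 0] by (simp add: index_pairs_0)
next
  case (Suc n)
  have "card (index_pairs (\<lambda>_. True) (Suc n)) = card (index_pairs (\<lambda>_. True) n) + (n - 1)"
    by (simp only: card_index_pairs_Suc simp_thms Collect_mem_eq card_atLeastLessThan)
  with Suc show ?case
    by (simp add: of_nat_diff field_simps)
qed

lemma card_index_pairs_odd:
  "real (card (index_pairs odd n)) =
    (if odd n then (real n - 1) ^ 2 / 4 else real n * (real n - 2) / 4)"
proof (induction n)
  case (Suc n)
  \<comment> \<open>The increment \<open>n div 2\<close> is rewritten without integer division, so
    that each parity becomes a polynomial identity; the parity flips from \<open>n\<close> to
    \<open>Suc n\<close>.\<close>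
  have "real (n div 2) = (if odd n then (real n - 1) / 2 else real n / 2)"
    by (auto elim!: evenE oddE)
  with Suc show ?case
    using card_index_pairs_Suc[of odd n, unfolded card_odd_below]
    by (auto simp: power2_eq_square field_simps)
qed (simp add: index_pairs_0)

theorem theorem4p2:
  fixes n :: nat and t :: "nat \<Rightarrow> real"
  assumes "n \<ge> 3"
    and "\<And>i. i \<in> {1..n - 1} \<Longrightarrow> t i > 0"
    and "strict_antimono_on {1..n - 1} t"
  shows "real (card (F_set n)) = (real n ^ 2 - 3 * real n + 4) / 2
    \<and> real (card (F_plus_set n)) =
           (if odd n then (real n ^ 2 - 2 * real n + 5) / 4
            else (real n ^ 2 - 2 * real n + 4) / 4)
    \<and> real (card (F_plus_set n \<times> T_set n t)) =
           (if odd n then (real n ^ 3 - 3 * real n ^ 2 + 7 * real n - 5) / 4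
            else (real n ^ 3 - 3 * real n ^ 2 + 6 * real n - 4) / 4)"
proof -
  have F: "real (card (F_set n)) = (real n ^ 2 - 3 * real n + 4) / 2"
    using assms(1) card_y_vecs[of n "\<lambda>_. True"] card_index_pairs_all[of n]
    by (simp add: F_set_def field_simps power2_eq_square)
  have Fp: "real (card (F_plus_set n)) =
      (if odd n then (real n ^ 2 - 2 * real n + 5) / 4
       else (real n ^ 2 - 2 * real n + 4) / 4)"
    using assms(1) card_y_vecs[of n odd] card_index_pairs_odd[of n]
    by (simp add: F_plus_set_def field_simps power2_eq_square)
  \<comment> \<open>Strict decrease makes the \<open>t i\<close> distinct, so
    \<open>T_set n t\<close> has exactly \<open>n - 1\<close> elements.\<close>
  have "inj_on t {1..n - 1}"
    using monotone_onD[OF assms(3)] by (intro linorder_inj_onI') (metis less_irrefl)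
  then have T: "real (card (T_set n t)) = real n - 1"
    using assms(1) by (simp add: T_set_def card_image of_nat_diff)
  \<comment> \<open>In each parity the cubic is the quadratic count of \<open>Fp\<close> multiplied
    by \<open>n - 1\<close>.\<close>
  have "real (card (F_plus_set n \<times> T_set n t)) =
      (if odd n then (real n ^ 3 - 3 * real n ^ 2 + 7 * real n - 5) / 4
       else (real n ^ 3 - 3 * real n ^ 2 + 6 * real n - 4) / 4)"
    by (simp add: card_cartesian_product T Fp field_simps power2_eq_square power3_eq_cube)
  with F Fp show ?thesis
    by blast
qed

end
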